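(* Let $p$ be an odd prime and let $k\ge 2$ be an even integer dividing $p-1$; write $p=km+1$. Let $0<\alpha_1<\alpha_2<\cdots<\alpha_m<p$ be all the $k$-th power residues modulo $p$ in the interval $(0,p)$, and let $$W_p(k)=\left[\left(\frac{\alpha_i+\alpha_j}{p}\right)\right]_{1\le i,j\le m},$$ where $\left(\frac{\cdot}{p}\right)$ is the Legendre symbol. Define integers $a_p(k)$ and $b_p(k)$ by $$p+1-a_p(k)=\#\{(x,y)\in\mathbb{F}_p\times\mathbb{F}_p:\ y^2=x^k+1\}+1,\qquad p+1-b_p(k)=\#\{(x,y)\in\mathbb{F}_p\times\mathbb{F}_p:\ y^2=x(x^k+1)\}+1.$$ Then: (i) If $m$ is odd, then $\det W_p(k)=-(a_p(k)+1)u_p(k)^2/k$ for some $u_p(k)\in\mathbb{Z}$. (ii) If $m$ is even, then $\det W_p(k)=(a_p(k)+1)b_p(k)v_p(k)^2/k^2$ for some $v_p(k)\in\mathbb{Z}$.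
   Context: $\mathbb{F}_p$ denotes the finite field with $p$ elements. An integer $\alpha$ with $p\nmid\alpha$ is a $k$-th power residue modulo $p$ if $\alpha\equiv x^k\pmod p$ for some integer $x$. The "+1" in the definitions of $a_p(k)$, $b_p(k)$ accounts for a single point at infinity added to the affine points. *)

theory Defs
  imports
    "HOL-Number_Theory.Residues"
    "Jordan_Normal_Form.Determinant"
begin

definition power_residue :: "nat \<Rightarrow> nat \<Rightarrow> int \<Rightarrow> bool" where
  "power_residue p k a \<longleftrightarrow> \<not> int p dvd a \<and> (\<exists>x::int. [a = x ^ k] (mod int p))"

text \<open>Matrix indices start at 0, whereas \<open>\<alpha>\<close> is indexed by \<open>1, \<dots>, m\<close>.\<close>

definition W_mat :: "nat \<Rightarrow> nat \<Rightarrow> (nat \<Rightarrow> int) \<Rightarrow> int mat" where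
  "W_mat p m \<alpha> = mat m m (\<lambda>(i, j). Legendre (\<alpha> (i + 1) + \<alpha> (j + 1)) (int p))"

definition a_coeff :: "nat \<Rightarrow> nat \<Rightarrow> int" where
  "a_coeff p k = (let F = residue_ring (int p) in
     int p + 1 - (int (card {(x, y) \<in> carrier F \<times> carrier F.
        y [^]\<^bsub>F\<^esub> (2::nat) = x [^]\<^bsub>F\<^esub> k \<oplus>\<^bsub>F\<^esub> \<one>\<^bsub>F\<^esub>}) + 1))"

definition b_coeff :: "nat \<Rightarrow> nat \<Rightarrow> int" where
  "b_coeff p k = (let F = residue_ring (int p) in
     int p + 1 - (int (card {(x, y) \<in> carrier F \<times> carrier F.
        y [^]\<^bsub>F\<^esub> (2::nat) = x \<otimes>\<^bsub>F\<^esub> (x [^]\<^bsub>F\<^esub> k \<oplus>\<^bsub>F\<^esub> \<one>\<^bsub>F\<^esub>)}) + 1))"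

end

theory Submission
  imports Defs "HOL-Number_Theory.Residue_Primitive_Roots" "HOL-Number_Theory.Euler_Criterion"
begin

text \<open>
  Let \<open>\<gamma>\<close> be a primitive root modulo \<open>p\<close>. The \<open>k\<close>-th power residues are the powers of \<open>\<gamma>\<^sup>k\<close>, and they
  are squares because \<open>k\<close> is even. Hence, after a simultaneous permutation of rows and columns, the
  matrix is the circulant with entries \<open>c (j - i)\<close>, where
  \<open>c t = Legendre (1 + \<gamma> ^ (k * t)) p\<close> is periodic modulo \<open>m\<close> and even.

  An even circulant commutes with the reflection \<open>i \<mapsto> - i\<close> and with the central difference \<open>D\<close>, which
  exchanges even and odd functions. So it acts by the same integer matrix \<open>M\<close> on the odd functions
  and on their images under \<open>D\<close>. The kernel of \<open>D\<close> supplies the missing eigenvectors: the constants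
  and, for even \<open>m\<close>, the alternating function. The determinant is therefore \<open>(det M)\<^sup>2\<close> times their
  eigenvalues, and these are the character sums \<open>- (a + 1) / k\<close> and \<open>- b / k\<close>.
\<close>

section \<open>Functions on the integers modulo m, encoded as periodic functions on all
  integers\<close>

definition periodic :: "nat \<Rightarrow> (int \<Rightarrow> 'a) \<Rightarrow> bool" where
  "periodic m f \<longleftrightarrow> (\<forall>x. f (x + int m) = f x)"

lemma periodicD: "periodic m f \<Longrightarrow> f (x + int m) = f x"
  by (simp add: periodic_def)

lemma periodic_shift:
  assumes "periodic m f"
  shows "periodic m (\<lambda>t. f (i + t))"
  using assms by (simp add: periodic_def add.assoc[symmetric])

lemma periodic_mult: "periodic m f \<Longrightarrow> periodic m g \<Longrightarrow> periodic m (\<lambda>t. f t * g t)"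
  by (simp add: periodic_def)

lemma periodic_cong:
  assumes "periodic m f" "[x = y] (mod int m)"
  shows "f x = f y"
proof -
  have nat_mult: "f (z + int m * int n) = f z" for z n
  proof (induction n)
    case (Suc n)
    have "f (z + int m * int (Suc n)) = f ((z + int m * int n) + int m)"
      by (simp add: algebra_simps)
    then show ?case using Suc periodicD[OF assms(1)] by simp
  qed simp
  obtain q where q: "y = x + int m * q"
    using assms(2) by (auto simp: cong_iff_lin)
  show ?thesis
  proof (cases "q \<ge> 0")
    case True
    then show ?thesis using nat_mult[of x "nat q"] q by simp
  next
    case False
    then show ?thesis using nat_mult[of y "nat (- q)"] q by simp
  qed
qed

text \<open>Reducing \<open>\<phi>\<close> modulo m gives an injective self-map of the finite set
  {..<m}, hence a permutation of the summation range. It is applied to translations and to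
  negation.\<close>

lemma sum_periodic_reindex:
  fixes f :: "int \<Rightarrow> 'a::comm_monoid_add"
  assumes f: "periodic m f"
    and \<phi>: "\<And>x y. [\<phi> x = \<phi> y] (mod int m) \<Longrightarrow> [x = y] (mod int m)"
  shows "(\<Sum>t<m. f (\<phi> (int t))) = (\<Sum>t<m. f (int t))"
proof (cases "m = 0")
  case False
  define \<psi> where "\<psi> t = nat (\<phi> (int t) mod int m)" for t
  have inj: "inj_on \<psi> {..<m}"
  proof (rule inj_onI)
    fix x y assume "x \<in> {..<m}" "y \<in> {..<m}" "\<psi> x = \<psi> y"
    then have "[\<phi> (int x) = \<phi> (int y)] (mod int m)"
      using False by (simp add: \<psi>_def cong_def eq_nat_nat_iff)
    from \<phi>[OF this] show "x = y"
      using \<open>x \<in> _\<close> \<open>y \<in> _\<close> by (simp add: cong_int_iff cong_less_modulus_unique_nat)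
  qed
  have sub: "\<psi> ` {..<m} \<subseteq> {..<m}"
    using False by (auto simp: \<psi>_def nat_less_iff)
  have "(\<Sum>t<m. f (\<phi> (int t))) = (\<Sum>t<m. f (int (\<psi> t)))"
    by (intro sum.cong refl periodic_cong[OF f]) (use False in \<open>simp add: \<psi>_def cong_def\<close>)
  also have "\<dots> = (\<Sum>t\<in>\<psi> ` {..<m}. f (int t))"
    by (simp add: sum.reindex[OF inj])
  also have "\<psi> ` {..<m} = {..<m}"
    by (rule endo_inj_surj[OF _ sub inj]) simp
  finally show ?thesis .
qed simp

section \<open>Circulant matrices and their action on periodic functions\<close>

definition circulant :: "nat \<Rightarrow> (int \<Rightarrow> 'a) \<Rightarrow> 'a mat" where
  "circulant m c = mat m m (\<lambda>(i, j). c (int j - int i))"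

text \<open>This is the operator of \<open>circulant m c\<close> on column vectors, with the row sum
  shifted so that c is evaluated at the summation index. Defined at every integer i, it again yields
  a periodic function.\<close>

definition cyclic_corr :: "nat \<Rightarrow> (int \<Rightarrow> 'a::comm_ring_1) \<Rightarrow> (int \<Rightarrow> 'a) \<Rightarrow> int \<Rightarrow> 'a" where
  "cyclic_corr m c f i = (\<Sum>t<m. c (int t) * f (i + int t))"

lemma periodic_cyclic_corr: "periodic m f \<Longrightarrow> periodic m (cyclic_corr m c f)"
proof -
  assume f: "periodic m f"
  have "f (x + int m + t) = f (x + t)" for x t
    using periodicD[OF f, of "x + t"] by (simp add: ac_simps)
  then show ?thesis by (simp add: periodic_def cyclic_corr_def)
qed

lemma circulant_row_sum:
  assumes "periodic m c" "periodic m f"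
  shows "(\<Sum>t<m. c (int t - i) * f (int t)) = cyclic_corr m c f i"
proof -
  have "periodic m (\<lambda>t. c t * f (i + t))"
    by (intro periodic_mult periodic_shift assms)
  from sum_periodic_reindex[OF this, of "\<lambda>t. t - i"] show ?thesis
    by (simp add: cyclic_corr_def cong_iff_dvd_diff)
qed

section \<open>Odd functions and their coordinates\<close>

definition skew :: "(int \<Rightarrow> 'a::ab_group_add) \<Rightarrow> bool" where
  "skew f \<longleftrightarrow> (\<forall>x. f (- x) = - f x)"

lemma skewD: "skew f \<Longrightarrow> f (- x) = - f x"
  by (simp add: skew_def)

text \<open>Substituting -t for t leaves c unchanged because c is even, and moves the sign into the
  argument of f.\<close>

lemma skew_cyclic_corr:
  assumes "periodic m c" "\<And>t. c (- t) = c t" "periodic m f" "skew f"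
  shows "skew (cyclic_corr m c f)"
  unfolding skew_def
proof
  fix i
  have per: "periodic m (\<lambda>t. c t * f (- i + t))"
    by (intro periodic_mult periodic_shift assms)
  have inj: "[x = y] (mod int m)" if "[- x = - y] (mod int m)" for x y
    using that by (simp add: cong_minus_minus_iff)
  have "cyclic_corr m c f (- i) = (\<Sum>t<m. c (- int t) * f (- i + (- int t)))"
    unfolding cyclic_corr_def
    using sum_periodic_reindex[OF per, of uminus, OF inj, symmetric] by simp
  also have "\<dots> = (\<Sum>t<m. - (c (int t) * f (i + int t)))"
  proof (rule sum.cong[OF refl])
    fix t
    show "c (- int t) * f (- i + (- int t)) = - (c (int t) * f (i + int t))"
      using skewD[OF assms(4), of "i + int t"] assms(2) by simp
  qed
  finally show "cyclic_corr m c f (- i) = - cyclic_corr m c f i"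
    by (simp add: cyclic_corr_def sum_negf)
qed

text \<open>The antisymmetrised indicator of a residue class. It vanishes when 2s is divisible by m,
  so the classes fixed by the reflection contribute no basis vector.\<close>

definition skew_unit :: "nat \<Rightarrow> nat \<Rightarrow> int \<Rightarrow> 'a::comm_ring_1" where
  "skew_unit m s i = of_bool [i = int s] (mod int m) - of_bool [i = - int s] (mod int m)"

lemma periodic_skew_unit: "periodic m (skew_unit m s)"
  by (simp add: periodic_def skew_unit_def cong_def)

lemma skew_skew_unit: "skew (skew_unit m s)"
proof -
  have "[- i = int s] (mod int m) \<longleftrightarrow> [i = - int s] (mod int m)" for i
    using cong_minus_minus_iff[of i "- int s" "int m"] by simp
  moreover have "[- i = - int s] (mod int m) \<longleftrightarrow> [i = int s] (mod int m)" for i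
    by (rule cong_minus_minus_iff)
  ultimately show ?thesis by (simp add: skew_def skew_unit_def)
qed

text \<open>Both indices lie in 1..h, so their sum lies strictly between 0 and m: the indicator of
  the negative class is never 1 there, and congruence of the two indices means equality.\<close>

lemma skew_unit_at:
  assumes "2 * h < m" "s < h" "0 < i" "i \<le> int h"
  shows "skew_unit m (Suc s) i = of_bool (i = int (Suc s))"
proof -
  have "[i = int (Suc s)] (mod int m) \<longleftrightarrow> i = int (Suc s)"
    using assms by (auto simp: cong_def)
  moreover have "\<not> [i = - int (Suc s)] (mod int m)"
  proof
    assume "[i = - int (Suc s)] (mod int m)"
    then have "int m dvd i + int (Suc s)" by (metis cong_iff_dvd_diff diff_minus_eq_add)
    then have "int m \<le> i + int (Suc s)" using assms by (intro zdvd_imp_le) auto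
    then show False using assms by linarith
  qed
  ultimately show ?thesis by (simp add: skew_unit_def)
qed

text \<open>The bounds say that h is the floor of (m - 1) / 2. An odd periodic function is
  determined by its values at 1..h: it vanishes at the classes fixed by the reflection, and
  reflection gives the remaining classes. The coordinates are values of f, so no division
  enters.\<close>

lemma skew_expansion:
  fixes f :: "int \<Rightarrow> 'a::{idom,ring_char_0}"
  assumes "2 * h < m" "m \<le> 2 * h + 2" "periodic m f" "skew f"
  shows "f i = (\<Sum>s<h. f (int (Suc s)) * skew_unit m (Suc s) i)" (is "_ = ?g i")
proof -
  have g: "periodic m ?g"
    by (simp add: periodic_def periodicD[OF periodic_skew_unit])
  have g_neg: "?g (- x) = - ?g x" for x
    by (simp add: skewD[OF skew_skew_unit] sum_negf)
  \<comment> \<open>Stated for arbitrary u because it is needed both for f and for its expansion: at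
    a fixed class u x = - u x, and 2 is not a zero divisor.\<close>
  have zero: "u x = 0" if "periodic m u" "u (- x) = - u x" "2 * x mod int m = 0"
    for u :: "int \<Rightarrow> 'a" and x
  proof -
    have "[x = - x] (mod int m)"
      using that(3) by (simp add: cong_iff_dvd_diff dvd_eq_mod_eq_0)
    then have "u x = - u x" using periodic_cong[OF that(1)] that(2) by metis
    then show ?thesis by simp
  qed
  have half: "f x = ?g x" if x: "0 \<le> x" "2 * x \<le> int m" for x
  proof (cases "2 * x mod int m = 0")
    case True
    then show ?thesis
      using zero[OF assms(3) skewD[OF assms(4)] True] zero[OF g g_neg True] by simp
  next
    case False
    \<comment> \<open>Excluding 2x = 0 and 2x = m leaves 0 < 2x < m, and m is at most 2h +
      2.\<close>
    then have x': "0 < x" "x \<le> int h"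
      using x assms(1,2) by (auto simp: order_le_less)
    then have "?g x = (\<Sum>s<h. if s = nat x - 1 then f (int (Suc s)) else 0)"
      using assms(1) by (intro sum.cong refl) (auto simp: skew_unit_at)
    also have "\<dots> = f x"
      using x' by (subst sum.delta) auto
    finally show ?thesis by simp
  qed
  define r where "r = i mod int m"
  have r: "0 \<le> r" "r < int m" "[i = r] (mod int m)"
    using assms(1) by (simp_all add: r_def cong_def)
  show ?thesis
  proof (cases "2 * r \<le> int m")
    case True
    then show ?thesis
      using half[of r] r periodic_cong[OF assms(3) r(3)] periodic_cong[OF g r(3)] by simp
  next
    case False
    have c: "[i = - (int m - r)] (mod int m)" using r(3) by (simp add: cong_def)
    have "f (int m - r) = ?g (int m - r)" using half r False by simp
    then show ?thesis
      unfolding periodic_cong[OF assms(3) c] periodic_cong[OF g c] g_neg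
        skewD[OF assms(4)] by simp
  qed
qed

section \<open>The central difference and its kernel\<close>

definition central_diff :: "(int \<Rightarrow> 'a::ab_group_add) \<Rightarrow> int \<Rightarrow> 'a" where
  "central_diff f i = f (i + 1) - f (i - 1)"

lemma periodic_central_diff: "periodic m f \<Longrightarrow> periodic m (central_diff f)"
proof -
  assume f: "periodic m f"
  have "f (x + int m + 1) = f (x + 1)" "f (x + int m - 1) = f (x - 1)" for x
    using periodicD[OF f, of "x + 1"] periodicD[OF f, of "x - 1"] by (simp_all add: algebra_simps)
  then show ?thesis by (simp add: periodic_def central_diff_def)
qed

text \<open>The correlation is linear and commutes with translations, and the central difference is
  a difference of two translations.\<close>

lemma cyclic_corr_central_diff:
  "cyclic_corr m c (central_diff f) i = central_diff (cyclic_corr m c f) i"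
  by (simp add: cyclic_corr_def central_diff_def sum_subtractf[symmetric] algebra_simps)

text \<open>In steps of 2, f runs through an arithmetic progression with common difference
  \<open>central_diff f i\<close>. After m steps periodicity brings it back to its start, so m times
  that difference is 0; characteristic 0 finishes.\<close>

lemma central_diff_eq_0_if_step2:
  fixes f :: "int \<Rightarrow> 'a::{idom,ring_char_0}"
  assumes "m > 0" "periodic m f" "\<And>i. central_diff f (i + 2) = central_diff f i"
  shows "central_diff f i = 0"
proof -
  have const: "central_diff f (i + 2 * int n) = central_diff f i" for n
  proof (induction n)
    case (Suc n)
    then show ?case using assms(3)[of "i + 2 * int n"] by (simp add: algebra_simps)
  qed simp
  have "f (i - 1 + 2 * int n) = f (i - 1) + of_nat n * central_diff f i" for n
  proof (induction n)
    case (Suc n)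
    have "central_diff f (i + 2 * int n) = f (i - 1 + 2 * int (Suc n)) - f (i - 1 + 2 * int n)"
      by (simp add: central_diff_def algebra_simps)
    then have "f (i - 1 + 2 * int (Suc n)) = f (i - 1 + 2 * int n) + central_diff f i"
      using const[of n] by (simp add: algebra_simps)
    then show ?case using Suc by (simp add: algebra_simps)
  qed simp
  from this[of m] have "of_nat m * central_diff f i = 0"
    using periodic_cong[OF assms(2), of "i - 1 + 2 * int m" "i - 1"] by (simp add: cong_def)
  then show ?thesis using assms(1) by simp
qed

text \<open>A vanishing central difference makes f 2-periodic. Since i and -i have the same parity,
  f i equals its own negative.\<close>

lemma skew_eq_0_if_central_diff_eq_0:
  fixes f :: "int \<Rightarrow> 'a::{idom,ring_char_0}"
  assumes "skew f" "\<And>i. central_diff f i = 0"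
  shows "f i = 0"
proof -
  have step: "f (x + 2) = f x" for x
    using assms(2)[of "x + 1"] by (simp add: central_diff_def add.commute)
  have per: "periodic 2 f" using step by (simp add: periodic_def)
  have "[i = - i] (mod int 2)" by (simp add: cong_iff_dvd_diff)
  then have "f i = - f i" using periodic_cong[OF per] skewD[OF assms(1)] by metis
  then show ?thesis by simp
qed


section \<open>A basis adapted to the symmetries, and the determinant of an even circulant\<close>

definition sign_char :: "nat \<Rightarrow> int \<Rightarrow> 'a::comm_ring_1" where
  "sign_char s i = (if even s \<or> even i then 1 else - 1)"

lemma sign_char_add: "sign_char s (i + j) = sign_char s i * sign_char s j"
  by (auto simp: sign_char_def)

lemma sum_lessThan_add:
  fixes f :: "nat \<Rightarrow> 'a::comm_monoid_add"
  shows "(\<Sum>s<a + b. f s) = (\<Sum>s<a. f s) + (\<Sum>s<b. f (a + s))"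
  by (induction b) (simp_all add: ac_simps)

text \<open>The first d functions are the constant 1 and, for d = 2, the alternating function. Then
  come h odd functions and, in the same order, their central differences, so that the two groups of
  size h transform by identical blocks.\<close>

definition symmetry_basis :: "nat \<Rightarrow> nat \<Rightarrow> nat \<Rightarrow> nat \<Rightarrow> int \<Rightarrow> 'a::comm_ring_1" where
  "symmetry_basis m d h s =
     (if s < d then sign_char s
      else if s < d + h then skew_unit m (Suc (s - d))
      else central_diff (skew_unit m (Suc (s - d - h))))"

lemma symmetry_basis_simps:
  "s < d \<Longrightarrow> symmetry_basis m d h s = sign_char s"
  "s < h \<Longrightarrow> symmetry_basis m d h (d + s) = skew_unit m (Suc s)"
  "symmetry_basis m d h (d + (h + s)) = central_diff (skew_unit m (Suc s))"
  by (simp_all add: symmetry_basis_def)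

text \<open>The alternating function occurs only for d = 2, and then m is even.\<close>

lemma periodic_symmetry_basis:
  assumes "m = d + 2 * h" "d = 1 \<or> d = 2"
  shows "periodic m (symmetry_basis m d h s)"
proof -
  have "periodic m (sign_char s)" if "s < d"
    using that assms by (auto simp: periodic_def sign_char_def)
  then show ?thesis
    by (auto simp: symmetry_basis_def intro: periodic_skew_unit periodic_central_diff)
qed

text \<open>Group a vanishing combination as E + f + Dg, where f and g are odd and E is spanned by
  the sign characters. Parity forces f = 0. Then Dg = - E has period 2, which forces Dg = 0, hence g
  = 0 and E = 0. Evaluation at 1..h and at 0 and 1 recovers the coefficients.\<close>

lemma symmetry_basis_lin_indep:
  fixes v :: "nat \<Rightarrow> 'a::{idom,ring_char_0}"
  assumes m: "m = d + 2 * h" and d: "d = 1 \<or> d = 2"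
    and v: "\<And>i. (\<Sum>s<m. v s * symmetry_basis m d h s i) = 0" and "s < m"
  shows "v s = 0"
proof -
  define E where "E i = (\<Sum>s<d. v s * sign_char s i)" for i
  define f where "f i = (\<Sum>s<h. v (d + s) * skew_unit m (Suc s) i)" for i
  define g where "g i = (\<Sum>s<h. v (d + (h + s)) * skew_unit m (Suc s) i)" for i
  have "E i + f i + central_diff g i = (\<Sum>s<d + (h + h). v s * symmetry_basis m d h s i)" for i
    unfolding sum_lessThan_add E_def f_def g_def central_diff_def
    by (simp add: symmetry_basis_simps central_diff_def sum_subtractf[symmetric] right_diff_distrib add.assoc)
  moreover have "m = d + (h + h)" using m by simp
  ultimately have sum0: "E i + f i + central_diff g i = 0" for i
    using v by simp
  have skew: "skew f" "skew g"
    by (simp_all add: skew_def f_def g_def skewD[OF skew_skew_unit] sum_negf)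
  have g: "periodic m g"
    by (simp add: periodic_def g_def periodicD[OF periodic_skew_unit])
  have E_neg: "E (- i) = E i" for i
    by (simp add: E_def sign_char_def)
  have E_2: "E (i + 2) = E i" for i
    by (simp add: E_def sign_char_def)
  \<comment> \<open>Both E and Dg are even, so comparing the relation at i and at -i isolates the
    odd part.\<close>
  have f0: "f i = 0" for i
  proof -
    have "central_diff g (- i) = central_diff g i"
      using skewD[OF skew(2), of "i + 1"] skewD[OF skew(2), of "i - 1"]
      by (simp add: central_diff_def)
    then have "E i + central_diff g i = f i"
      using sum0[of "- i"] skewD[OF skew(1), of i] E_neg[of i] by (simp add: algebra_simps)
    moreover have "E i + central_diff g i = - f i"
      using sum0[of i] by (simp add: eq_neg_iff_add_eq_0 algebra_simps)
    ultimately show ?thesis by simp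
  qed
  have cd: "central_diff g i = - E i" for i
    using sum0[of i] f0[of i] by (simp add: eq_neg_iff_add_eq_0 add.commute)
  have cd0: "central_diff g i = 0" for i
    by (rule central_diff_eq_0_if_step2[OF _ g]) (use m d E_2 cd in auto)
  have g0: "g i = 0" for i
    by (rule skew_eq_0_if_central_diff_eq_0[OF skew(2) cd0])
  have E0: "E i = 0" for i
    using cd[of i] cd0[of i] by simp
  have m2: "2 * h < m" using m d by auto
  have coeff: "(\<Sum>r<h. w r * skew_unit m (Suc r) (int (Suc r'))) = w r'"
    if "r' < h" for w :: "nat \<Rightarrow> 'a" and r'
  proof -
    have "(\<Sum>r<h. w r * skew_unit m (Suc r) (int (Suc r'))) = (\<Sum>r<h. if r = r' then w r else 0)"
      using that m2 by (intro sum.cong refl) (auto simp: skew_unit_at)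
    then show ?thesis using that by simp
  qed
  have f_coeff: "v (d + r) = 0" if "r < h" for r
    using coeff[OF that, of "\<lambda>r. v (d + r)"] f0[of "int (Suc r)"] by (simp add: f_def)
  have g_coeff: "v (d + (h + r)) = 0" if "r < h" for r
    using coeff[OF that, of "\<lambda>r. v (d + (h + r))"] g0[of "int (Suc r)"] by (simp add: g_def)
  have E_coeff: "v r = 0" if "r < d" for r
  proof (cases "d = 1")
    case True
    then show ?thesis using E0[of 0] that by (simp add: E_def sign_char_def)
  next
    case False
    then have "d = 2" using d by simp
    then have "v 0 + v 1 = 0" "v 0 - v 1 = 0"
      using E0[of 0] E0[of 1] by (simp_all add: E_def sign_char_def numeral_2_eq_2)
    then have "v 0 = v 1" "2 * v 1 = 0" by simp_all
    then show ?thesis using that \<open>d = 2\<close> by (auto simp: less_2_cases_iff)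
  qed
  consider "s < d" | r where "s = d + r" "r < h" | r where "s = d + (h + r)" "r < h"
  proof -
    have "s < d \<or> (\<exists>r<h. s = d + r) \<or> (\<exists>r<h. s = d + (h + r))"
      using \<open>s < m\<close> m by presburger
    then show ?thesis using that by blast
  qed
  then show ?thesis using E_coeff f_coeff g_coeff by cases auto
qed

text \<open>The columns of \<open>B\<close> are the basis functions, and \<open>N\<close> is block
  diagonal with blocks \<open>P\<close>, \<open>M\<close>, \<open>M\<close>, so the witness is u =
  det \<open>M\<close>. \<open>B\<close> need not be invertible over the ring: its determinant is
  nonzero and is cancelled in a domain, which keeps u in the ring itself.\<close>

theorem det_even_circulant:
  fixes c :: "int \<Rightarrow> 'a::{idom,ring_char_0}"
  assumes m: "m = d + 2 * h" and d: "d = 1 \<or> d = 2"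
    and c: "periodic m c" "\<And>t. c (- t) = c t"
  shows "\<exists>u. det (circulant m c) = (\<Prod>s<d. \<Sum>t<m. c (int t) * sign_char s (int t)) * u ^ 2"
proof -
  define b :: "nat \<Rightarrow> int \<Rightarrow> 'a" where "b = symmetry_basis m d h"
  define \<mu> where "\<mu> s = (\<Sum>t<m. c (int t) * sign_char s (int t))" for s
  define B where "B = mat m m (\<lambda>(i, s). b s (int i))"
  define P where "P = mat d d (\<lambda>(s, r). if s = r then \<mu> s else 0)"
  define M where "M = mat h h (\<lambda>(s, r). cyclic_corr m c (skew_unit m (Suc r)) (int (Suc s)))"
  define N where "N = four_block_mat P (0\<^sub>m d (h + h)) (0\<^sub>m (h + h) d)
                        (four_block_mat M (0\<^sub>m h h) (0\<^sub>m h h) M)"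
  have mh: "m = d + (h + h)" "2 * h < m" "m \<le> 2 * h + 2" using m d by auto
  have carr: "B \<in> carrier_mat m m" "P \<in> carrier_mat d d" "M \<in> carrier_mat h h"
    "N \<in> carrier_mat m m" "circulant m c \<in> carrier_mat m m"
    by (auto simp: B_def P_def M_def N_def circulant_def mh(1))
  have b: "periodic m (b s)" for s
    unfolding b_def by (rule periodic_symmetry_basis[OF m d])
  \<comment> \<open>The image of an odd function is odd, so its values at 1..h, which fill a column
    of \<open>M\<close>, are its coordinates.\<close>
  have corr_skew: "cyclic_corr m c (skew_unit m (Suc r)) i
      = (\<Sum>s<h. skew_unit m (Suc s) i * M $$ (s, r))" if "r < h" for r i
    by (subst skew_expansion[OF mh(2,3) periodic_cyclic_corr[OF periodic_skew_unit]
        skew_cyclic_corr[OF c periodic_skew_unit skew_skew_unit]])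
      (use that in \<open>simp add: M_def mult.commute\<close>)
  have eigen: "cyclic_corr m c (b r) i = (\<Sum>s<m. b s i * N $$ (s, r))" if "r < m" for r i
  proof -
    have split: "(\<Sum>s<m. b s i * N $$ (s, r)) = (\<Sum>s<d. sign_char s i * N $$ (s, r)) +
      ((\<Sum>s<h. skew_unit m (Suc s) i * N $$ (d + s, r)) +
       (\<Sum>s<h. central_diff (skew_unit m (Suc s)) i * N $$ (d + (h + s), r)))"
      unfolding mh(1) sum_lessThan_add by (simp add: b_def symmetry_basis_simps mh(1))
    consider "r < d" | q where "r = d + q" "q < h" | q where "r = d + (h + q)" "q < h"
    proof -
      have "r < d \<or> (\<exists>q<h. r = d + q) \<or> (\<exists>q<h. r = d + (h + q))"
        using \<open>r < m\<close> m by presburger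
      then show ?thesis using that by blast
    qed
    then show ?thesis
    proof cases
      case 1
      have "(\<Sum>s<m. b s i * N $$ (s, r)) = (\<Sum>s<d. sign_char s i * P $$ (s, r))"
        unfolding split using 1 carr by (simp add: N_def)
      also have "\<dots> = (\<Sum>s<d. if s = r then sign_char s i * \<mu> s else 0)"
        using 1 by (intro sum.cong refl) (simp add: P_def)
      \<comment> \<open>Multiplicativity of \<open>sign_char\<close> makes it an eigenfunction, with
        eigenvalue \<open>\<mu> r\<close>.\<close>
      also have "\<dots> = cyclic_corr m c (b r) i"
        using 1 by (simp add: b_def symmetry_basis_simps cyclic_corr_def sign_char_add \<mu>_def
            sum_distrib_left ac_simps)
      finally show ?thesis by simp
    next
      case 2
      have "(\<Sum>s<m. b s i * N $$ (s, r)) = (\<Sum>s<h. skew_unit m (Suc s) i * M $$ (s, q))"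
        unfolding split using 2 carr by (simp add: N_def)
      then show ?thesis using 2 by (simp add: b_def symmetry_basis_simps corr_skew)
    next
      case 3
      have "(\<Sum>s<m. b s i * N $$ (s, r))
          = (\<Sum>s<h. central_diff (skew_unit m (Suc s)) i * M $$ (s, q))"
        unfolding split using 3 carr by (simp add: N_def)
      \<comment> \<open>The central difference commutes with the correlation, so the coordinates
        found for the odd functions reappear unchanged: this is the second copy of
        \<open>M\<close>.\<close>
      then show ?thesis
        using 3 by (simp add: b_def symmetry_basis_simps cyclic_corr_central_diff corr_skew
            central_diff_def sum_subtractf[symmetric] left_diff_distrib)
    qed
  qed
  have intertwine: "circulant m c * B = B * N"
  proof (rule eq_matI)
    fix i r assume "i < dim_row (B * N)" "r < dim_col (B * N)"
    then have ir: "i < m" "r < m" using carr by auto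
    have "(circulant m c * B) $$ (i, r) = (\<Sum>t<m. c (int t - int i) * b r (int t))"
      using ir by (simp add: circulant_def B_def scalar_prod_def atLeast0LessThan)
    also have "\<dots> = cyclic_corr m c (b r) (int i)"
      by (rule circulant_row_sum[OF c(1) b])
    also have "\<dots> = (B * N) $$ (i, r)"
      using ir carr(4) by (simp add: eigen B_def scalar_prod_def atLeast0LessThan)
    finally show "(circulant m c * B) $$ (i, r) = (B * N) $$ (i, r)" .
  qed (use carr in auto)
  have "det B \<noteq> 0"
  proof
    assume "det B = 0"
    then obtain v where v: "v \<in> carrier_vec m" "v \<noteq> 0\<^sub>v m" "B *\<^sub>v v = 0\<^sub>v m"
      using det_0_iff_vec_prod_zero[OF carr(1)] by blast
    have zero: "(\<Sum>s<m. v $ s * b s (int i)) = 0" if "i < m" for i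
    proof -
      have "(B *\<^sub>v v) $ i = (\<Sum>s<m. v $ s * b s (int i))"
        using that v(1) by (simp add: B_def scalar_prod_def atLeast0LessThan mult.commute)
      then show ?thesis using v(3) that by simp
    qed
    \<comment> \<open>The kernel vector gives a relation only at the matrix indices; periodicity
      extends it to all integers, as linear independence requires.\<close>
    have "(\<Sum>s<m. v $ s * b s i) = 0" for i
    proof -
      have c: "[i = int (nat (i mod int m))] (mod int m)" and l: "nat (i mod int m) < m"
        using mh(2) by (simp_all add: cong_def nat_less_iff)
      have "(\<Sum>s<m. v $ s * b s i) = (\<Sum>s<m. v $ s * b s (int (nat (i mod int m))))"
        using periodic_cong[OF b c] by simp
      then show ?thesis using zero[OF l] by simp
    qed
    then have "v $ s = 0" if "s < m" for s
      using symmetry_basis_lin_indep[OF m d, of "\<lambda>s. v $ s"] that unfolding b_def by blast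
    then have "v = 0\<^sub>v m" using v(1) by (intro eq_vecI) auto
    then show False using v(2) by simp
  qed
  moreover have "det (circulant m c) * det B = det B * det N"
    using intertwine det_mult[OF carr(5) carr(1)] det_mult[OF carr(1) carr(4)] by metis
  ultimately have "det (circulant m c) = det N" by simp
  also have "det N = det P * (det M * det M)"
    unfolding N_def
    by (subst det_four_block_mat_upper_right_zero[of P d _ "h + h"],
        use carr in \<open>auto simp: det_four_block_mat_upper_right_zero[OF carr(3) refl _ carr(3)]\<close>)
  also have "det P = (\<Prod>s<d. \<mu> s)"
    by (subst det_upper_triangular[of _ d])
      (auto simp: P_def prod_list_diag_prod atLeast0LessThan)
  finally show ?thesis
    by (auto simp: \<mu>_def power2_eq_square)
qed

text \<open>The sign of the permutation appears once for the rows and once for the columns, and its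
  square is 1. Columns are reduced to rows by transposition.\<close>

lemma det_permute_rows_cols:
  fixes f :: "nat \<Rightarrow> nat \<Rightarrow> 'a::comm_ring_1"
  assumes \<sigma>: "\<sigma> permutes {0..<n}"
  shows "det (mat n n (\<lambda>(i, j). f (\<sigma> i) (\<sigma> j))) = det (mat n n (\<lambda>(i, j). f i j))"
proof -
  have \<sigma>_less: "\<sigma> i < n" if "i < n" for i
    using permutes_in_image[OF \<sigma>, of i] that by simp
  have rows: "det (mat n n (\<lambda>(i, j). g (\<sigma> i) j)) = signof \<sigma> * det (mat n n (\<lambda>(i, j). g i j))"
    for g :: "nat \<Rightarrow> nat \<Rightarrow> 'a"
  proof -
    have "mat n n (\<lambda>(i, j). g (\<sigma> i) j)
        = mat n n (\<lambda>(i, j). mat n n (\<lambda>(i, j). g i j) $$ (\<sigma> i, j))"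
      by (rule eq_matI) (auto simp: \<sigma>_less)
    then show ?thesis using det_permute_rows[OF mat_carrier \<sigma>] by metis
  qed
  have transp: "det (mat n n (\<lambda>(i, j). g j i)) = det (mat n n (\<lambda>(i, j). g i j))"
    for g :: "nat \<Rightarrow> nat \<Rightarrow> 'a"
  proof -
    have "mat n n (\<lambda>(i, j). g j i) = transpose_mat (mat n n (\<lambda>(i, j). g i j))"
      by (rule eq_matI) auto
    then show ?thesis using det_transpose[of "mat n n (\<lambda>(i, j). g i j)" n] by simp
  qed
  have "det (mat n n (\<lambda>(i, j). f (\<sigma> i) (\<sigma> j)))
      = signof \<sigma> * det (mat n n (\<lambda>(i, j). f i (\<sigma> j)))"
    by (rule rows[of "\<lambda>i j. f i (\<sigma> j)"])
  also have "det (mat n n (\<lambda>(i, j). f i (\<sigma> j))) = det (mat n n (\<lambda>(i, j). f j (\<sigma> i)))"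
    by (rule transp[of "\<lambda>i j. f j (\<sigma> i)"])
  also have "\<dots> = signof \<sigma> * det (mat n n (\<lambda>(i, j). f j i))"
    by (rule rows[of "\<lambda>i j. f j i"])
  also have "det (mat n n (\<lambda>(i, j). f j i)) = det (mat n n (\<lambda>(i, j). f i j))"
    by (rule transp)
  also have "signof \<sigma> * (signof \<sigma> * det (mat n n (\<lambda>(i, j). f i j))) = det (mat n n (\<lambda>(i, j). f i j))"
    by (simp add: sign_def)
  finally show ?thesis .
qed

section \<open>Legendre symbols, character sums and point counts\<close>

lemma sum_lessThan_mult_periodic:
  fixes F :: "nat \<Rightarrow> 'a::comm_semiring_1"
  assumes "\<And>n. F (m + n) = F n"
  shows "(\<Sum>s<k * m. F s) = of_nat k * (\<Sum>t<m. F t)"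
proof (induction k)
  case (Suc k)
  have "(\<Sum>s<Suc k * m. F s) = (\<Sum>t<m. F t) + (\<Sum>s<k * m. F s)"
    using assms by (simp add: sum_lessThan_add)
  then show ?case using Suc by (simp add: algebra_simps)
qed simp

lemma Legendre_cong: "[a = b] (mod p) \<Longrightarrow> Legendre a p = Legendre b p"
  by (simp add: Legendre_def QuadRes_def cong_def)

text \<open>Euler's criterion gives the identity modulo p. Both sides lie in {-1, 0, 1}, so they
  differ by at most 2, which is less than p.\<close>

lemma Legendre_mult:
  assumes "prime p" "2 < p"
  shows "Legendre (a * b) (int p) = Legendre a (int p) * Legendre b (int p)"
proof -
  have "[Legendre (a * b) (int p) = (a * b) ^ ((p - 1) div 2)] (mod int p)"
    by (rule euler_criterion[OF assms])
  moreover have "[Legendre a (int p) * Legendre b (int p)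
      = a ^ ((p - 1) div 2) * b ^ ((p - 1) div 2)] (mod int p)"
    by (intro cong_mult euler_criterion assms)
  ultimately have "[Legendre (a * b) (int p) = Legendre a (int p) * Legendre b (int p)] (mod int p)"
    by (metis cong_sym cong_trans power_mult_distrib)
  then have "int p dvd Legendre (a * b) (int p) - Legendre a (int p) * Legendre b (int p)"
    by (simp add: cong_iff_dvd_diff)
  moreover have "\<bar>Legendre (a * b) (int p) - Legendre a (int p) * Legendre b (int p)\<bar> < int p"
    using assms(2) by (simp add: Legendre_def)
  ultimately have "Legendre (a * b) (int p) - Legendre a (int p) * Legendre b (int p) = 0"
    using dvd_imp_le_int[of "Legendre (a * b) (int p) - Legendre a (int p) * Legendre b (int p)" "int p"]
    by linarith
  then show ?thesis by simp
qed

lemma Legendre_1: "p > 1 \<Longrightarrow> Legendre 1 p = 1"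
  unfolding Legendre_def QuadRes_def by (auto simp: cong_def intro: exI[of _ 1])

lemma Legendre_power:
  assumes "prime p" "2 < p"
  shows "Legendre (a ^ n) (int p) = Legendre a (int p) ^ n"
  by (induction n) (use assms in \<open>simp_all add: Legendre_1 Legendre_mult\<close>)

lemma Legendre_sqr_eq_1: "\<not> int p dvd a \<Longrightarrow> Legendre a (int p) ^ 2 = 1"
  by (simp add: Legendre_def cong_0_iff)

lemma Legendre_even_power:
  assumes "prime p" "2 < p" "\<not> int p dvd a" "even n"
  shows "Legendre (a ^ n) (int p) = 1"
  using assms by (auto elim!: evenE simp: Legendre_power power_mult Legendre_sqr_eq_1)

lemma card_sqrt_mod:
  assumes "prime p" "2 < p"
  shows "int (card {y \<in> {0..<int p}. [y ^ 2 = a] (mod int p)}) = 1 + Legendre a (int p)"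
    (is "int (card ?Y) = _")
proof -
  have prime: "prime (int p)" using assms by simp
  consider "[a = 0] (mod int p)" | "\<not> [a = 0] (mod int p)" "QuadRes (int p) a"
    | "\<not> [a = 0] (mod int p)" "\<not> QuadRes (int p) a" by blast
  then show ?thesis
  proof cases
    case 1
    have "?Y = {0}"
    proof (intro equalityI subsetI)
      fix y assume "y \<in> ?Y"
      then have "[y ^ 2 = 0] (mod int p)" and y: "0 \<le> y" "y < int p" using 1 by (auto intro: cong_trans)
      then have "int p dvd y" using prime by (simp add: cong_0_iff prime_dvd_power_iff)
      then show "y \<in> {0}" using y zdvd_not_zless[of y "int p"] by fastforce
    qed (use 1 assms in \<open>auto intro: cong_sym\<close>)
    then show ?thesis using 1 by (simp add: Legendre_def)
  next
    case 2
    then obtain z where z: "[z ^ 2 = a] (mod int p)" by (auto simp: QuadRes_def)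
    define x where "x = z mod int p"
    have x: "[x ^ 2 = a] (mod int p)" "0 \<le> x" "x < int p"
      using z assms by (auto simp: x_def cong_def power_mod)
    have "x \<noteq> 0" using x(1) 2(1) cong_sym by (auto simp: cong_def)
    have "?Y = {x, int p - x}"
    proof (intro equalityI subsetI)
      fix y assume "y \<in> ?Y"
      then have y: "[y ^ 2 = a] (mod int p)" "0 \<le> y" "y < int p" by auto
      have "[y ^ 2 = x ^ 2] (mod int p)" using y(1) x(1) by (metis cong_sym cong_trans)
      then have "int p dvd (y - x) * (y + x)"
        by (simp add: cong_iff_dvd_diff power2_eq_square algebra_simps)
      then consider "int p dvd y - x" | "int p dvd y + x"
        using prime prime_dvd_mult_iff by blast
      then show "y \<in> {x, int p - x}"
      proof cases
        case 1
        then have "[y = x] (mod int p)" by (simp add: cong_iff_dvd_diff)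
        then show ?thesis using x y by (simp add: cong_def)
      next
        case 2
        then have "[y = int p - x] (mod int p)"
          by (simp add: cong_iff_dvd_diff algebra_simps)
        then have "y mod int p = (int p - x) mod int p" by (simp only: cong_def)
        moreover have "(int p - x) mod int p = int p - x"
          using x \<open>x \<noteq> 0\<close> by (intro mod_pos_pos_trivial) auto
        ultimately show ?thesis using y by simp
      qed
    next
      fix y assume "y \<in> {x, int p - x}"
      moreover have "[(int p - x) ^ 2 = x ^ 2] (mod int p)"
        by (simp add: cong_iff_dvd_diff power2_eq_square algebra_simps)
      ultimately show "y \<in> ?Y" using x \<open>x \<noteq> 0\<close> by (auto intro: cong_trans)
    qed
    moreover have "x \<noteq> int p - x"
      using prime_odd_nat[OF assms] by (metis diff_add_cancel even_add even_of_nat)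
    ultimately show ?thesis using 2 by (simp add: Legendre_def)
  next
    case 3
    then have Y: "?Y = {}" by (auto simp: QuadRes_def)
    have "card ?Y = 0" unfolding Y by simp
    then show ?thesis using 3 by (simp add: Legendre_def)
  qed
qed

text \<open>The points are counted fibre by fibre: above each x there are 1 + Legendre (f x) p
  values of y.\<close>

lemma card_points_Legendre:
  assumes "prime p" "2 < p"
  shows "int (card {(x, y) \<in> {0..<int p} \<times> {0..<int p}. [y ^ 2 = f x] (mod int p)})
       = int p + (\<Sum>x = 0..<int p. Legendre (f x) (int p))"
proof -
  have "{(x, y) \<in> {0..<int p} \<times> {0..<int p}. [y ^ 2 = f x] (mod int p)}
      = (SIGMA x:{0..<int p}. {y \<in> {0..<int p}. [y ^ 2 = f x] (mod int p)})" by auto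
  also have "int (card \<dots>) = (\<Sum>x\<in>{0..<int p}. 1 + Legendre (f x) (int p))"
    by (subst card_SigmaI)
      (simp_all only: of_nat_sum card_sqrt_mod[OF assms] finite_atLeastLessThan_int
        finite_Collect_conjI Collect_mem_eq simp_thms ball_triv)
  finally show ?thesis by (simp add: sum.distrib)
qed

text \<open>The point at infinity cancels the 1 in p + 1, and the p in the count of affine points
  cancels the other term, leaving minus the character sum.\<close>

lemma a_coeff_Legendre:
  assumes "prime p" "2 < p"
  shows "a_coeff p k = - (\<Sum>x = 0..<int p. Legendre (x ^ k + 1) (int p))"
proof -
  interpret residues_prime p "residue_ring (int p)" by unfold_locales (use assms in auto)
  let ?F = "residue_ring (int p)"
  have "{(x, y) \<in> carrier ?F \<times> carrier ?F. y [^]\<^bsub>?F\<^esub> (2::nat) = x [^]\<^bsub>?F\<^esub> k \<oplus>\<^bsub>?F\<^esub> \<one>\<^bsub>?F\<^esub>}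
      = {(x, y) \<in> {0..<int p} \<times> {0..<int p}. [y ^ 2 = x ^ k + 1] (mod int p)}"
  proof -
    have "y [^]\<^bsub>?F\<^esub> (2::nat) = x [^]\<^bsub>?F\<^esub> k \<oplus>\<^bsub>?F\<^esub> \<one>\<^bsub>?F\<^esub> \<longleftrightarrow> [y ^ 2 = x ^ k + 1] (mod int p)"
      if "x \<in> {0..<int p}" "y \<in> {0..<int p}" for x y
      using pow_cong[of x k] pow_cong[of y 2] that
      by (simp add: res_add_eq res_one_eq cong_def mod_simps)
    then show ?thesis by (auto simp: res_carrier_eq)
  qed
  then show ?thesis
    using card_points_Legendre[OF assms, of "\<lambda>x. x ^ k + 1"] by (simp add: a_coeff_def)
qed

lemma b_coeff_Legendre:
  assumes "prime p" "2 < p"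
  shows "b_coeff p k = - (\<Sum>x = 0..<int p. Legendre (x * (x ^ k + 1)) (int p))"
proof -
  interpret residues_prime p "residue_ring (int p)" by unfold_locales (use assms in auto)
  let ?F = "residue_ring (int p)"
  have "{(x, y) \<in> carrier ?F \<times> carrier ?F.
        y [^]\<^bsub>?F\<^esub> (2::nat) = x \<otimes>\<^bsub>?F\<^esub> (x [^]\<^bsub>?F\<^esub> k \<oplus>\<^bsub>?F\<^esub> \<one>\<^bsub>?F\<^esub>)}
      = {(x, y) \<in> {0..<int p} \<times> {0..<int p}. [y ^ 2 = x * (x ^ k + 1)] (mod int p)}"
  proof -
    have "y [^]\<^bsub>?F\<^esub> (2::nat) = x \<otimes>\<^bsub>?F\<^esub> (x [^]\<^bsub>?F\<^esub> k \<oplus>\<^bsub>?F\<^esub> \<one>\<^bsub>?F\<^esub>)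
        \<longleftrightarrow> [y ^ 2 = x * (x ^ k + 1)] (mod int p)"
      if "x \<in> {0..<int p}" "y \<in> {0..<int p}" for x y
      using pow_cong[of x k] pow_cong[of y 2] that
      by (simp add: res_add_eq res_mult_eq res_one_eq cong_def mod_simps)
    then show ?thesis by (auto simp: res_carrier_eq)
  qed
  then show ?thesis
    using card_points_Legendre[OF assms, of "\<lambda>x. x * (x ^ k + 1)"] by (simp add: b_coeff_def)
qed

section \<open>Power residues as powers of a primitive root\<close>

locale primroot_power_residues =
  fixes p k m \<gamma> :: nat
  assumes prime: "prime p" and gt_2: "2 < p"
    and even_k: "even k" and k_pos: "0 < k" and p_eq: "p = k * m + 1"
    and primroot: "residue_primroot p \<gamma>"
begin

lemma m_pos: "m > 0"
  using p_eq gt_2 by (cases m) auto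

lemma gamma_power_cong_iff: "[int \<gamma> ^ a = int \<gamma> ^ b] (mod int p) \<longleftrightarrow> [a = b] (mod (p - 1))"
proof -
  have "[int \<gamma> ^ a = int \<gamma> ^ b] (mod int p) \<longleftrightarrow> [\<gamma> ^ a = \<gamma> ^ b] (mod p)"
    by (metis cong_int_iff of_nat_power)
  then show ?thesis
    using primroot prime by (simp add: residue_primroot_def totient_prime order_divides_expdiff)
qed

lemma gamma_not_dvd: "\<not> int p dvd int \<gamma> ^ n"
proof -
  have "\<not> p dvd \<gamma>"
    using primroot gt_2 by (auto simp: residue_primroot_def)
  then show ?thesis using prime by (metis int_dvd_int_iff of_nat_power prime_dvd_power_nat)
qed

lemma bij_gamma_power: "bij_betw (\<lambda>s. int \<gamma> ^ s mod int p) {..<p - 1} {0<..<int p}"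
proof -
  have inj: "inj_on (\<lambda>s. int \<gamma> ^ s mod int p) {..<p - 1}"
  proof (rule inj_onI)
    fix s t assume st: "s \<in> {..<p - 1}" "t \<in> {..<p - 1}" "int \<gamma> ^ s mod int p = int \<gamma> ^ t mod int p"
    then have "[s = t] (mod (p - 1))" using gamma_power_cong_iff by (simp add: cong_def)
    then show "s = t" using st by (simp add: cong_less_modulus_unique_nat)
  qed
  have sub: "(\<lambda>s. int \<gamma> ^ s mod int p) ` {..<p - 1} \<subseteq> {0<..<int p}"
  proof
    fix x assume "x \<in> (\<lambda>s. int \<gamma> ^ s mod int p) ` {..<p - 1}"
    then obtain s where x: "x = int \<gamma> ^ s mod int p" by auto
    have "x \<noteq> 0" using gamma_not_dvd[of s] by (auto simp: x dvd_eq_mod_eq_0)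
    moreover have "0 \<le> x" "x < int p" using gt_2 by (simp_all add: x)
    ultimately show "x \<in> {0<..<int p}" by simp
  qed
  have "card {0<..<int p} = p - 1" using gt_2 by simp
  then have "(\<lambda>s. int \<gamma> ^ s mod int p) ` {..<p - 1} = {0<..<int p}"
    by (intro card_subset_eq[OF _ sub])
      (simp_all only: card_image[OF inj] card_lessThan finite_greaterThanLessThan_int)
  then show ?thesis using inj by (simp add: bij_betw_def)
qed

lemma sum_nonzero_residues:
  assumes "\<And>x y. [x = y] (mod int p) \<Longrightarrow> F x = F y"
  shows "(\<Sum>x = 0..<int p. F x) = F 0 + (\<Sum>s<k * m. F (int \<gamma> ^ s))"
proof -
  have "{0..<int p} = insert 0 {0<..<int p}" using gt_2 by auto
  then have "(\<Sum>x = 0..<int p. F x) = F 0 + (\<Sum>x\<in>{0<..<int p}. F x)" by simp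
  also have "(\<Sum>x\<in>{0<..<int p}. F x) = (\<Sum>s<p - 1. F (int \<gamma> ^ s mod int p))"
    by (rule sum.reindex_bij_betw[OF bij_gamma_power, symmetric])
  also have "\<dots> = (\<Sum>s<k * m. F (int \<gamma> ^ s))"
    using p_eq by (intro sum.cong assms) (simp_all add: cong_def)
  finally show ?thesis .
qed

text \<open>If the symbol were 1, Euler's criterion would give \<open>\<gamma>\<close> an order
  dividing (p - 1) / 2, but its order is p - 1.\<close>

lemma Legendre_gamma: "Legendre (int \<gamma>) (int p) = - 1"
proof (rule ccontr)
  assume "Legendre (int \<gamma>) (int p) \<noteq> - 1"
  then have "Legendre (int \<gamma>) (int p) = 1"
    using gamma_not_dvd[of 1] by (auto simp: Legendre_def cong_0_iff split: if_splits)
  then have "[int \<gamma> ^ ((p - 1) div 2) = int \<gamma> ^ 0] (mod int p)"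
    using euler_criterion[OF prime gt_2, of "int \<gamma>"] by (simp add: cong_sym)
  then have "(p - 1) dvd (p - 1) div 2"
    by (simp only: gamma_power_cong_iff cong_0_iff)
  then have "p - 1 \<le> (p - 1) div 2"
    using gt_2 by (intro dvd_imp_le) auto
  then show False using gt_2 by simp
qed

lemma gamma_k_power_cong:
  assumes "[a = b] (mod m)"
  shows "[int \<gamma> ^ (k * a) = int \<gamma> ^ (k * b)] (mod int p)"
proof -
  have "[k * a = k * b] (mod k * m)"
    using assms k_pos by (simp add: cong_def mult_mod_right[symmetric])
  then show ?thesis unfolding gamma_power_cong_iff by (simp add: p_eq)
qed

text \<open>Reducing t modulo m provides a natural exponent for a possibly negative t and makes c
  periodic by construction. The reduction is harmless because \<open>\<gamma> ^ k\<close> has order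
  m modulo p.\<close>

definition c :: "int \<Rightarrow> int" where
  "c t = Legendre (1 + int \<gamma> ^ (k * nat (t mod int m))) (int p)"

lemma periodic_c: "periodic m c"
  by (simp add: periodic_def c_def)

text \<open>Factor out \<open>\<gamma> ^ (k * a)\<close>: its Legendre symbol is 1 because k is
  even, and the other factor depends only on b - a modulo m.\<close>

lemma Legendre_add_powers:
  "Legendre (int \<gamma> ^ (k * a) + int \<gamma> ^ (k * b)) (int p) = c (int b - int a)"
proof -
  define r where "r = nat ((int b - int a) mod int m)"
  have "[int a + int r = int b] (mod int m)"
    using m_pos by (simp add: r_def cong_def mod_simps)
  then have "[b = a + r] (mod m)"
    by (metis cong_int_iff cong_sym of_nat_add)
  from gamma_k_power_cong[OF this]
  have "[int \<gamma> ^ (k * b) = int \<gamma> ^ (k * a) * int \<gamma> ^ (k * r)] (mod int p)"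
    by (simp add: distrib_left power_add)
  then have "[int \<gamma> ^ (k * a) + int \<gamma> ^ (k * b)
      = int \<gamma> ^ (k * a) + int \<gamma> ^ (k * a) * int \<gamma> ^ (k * r)] (mod int p)"
    by (rule cong_add[OF cong_refl])
  then have "Legendre (int \<gamma> ^ (k * a) + int \<gamma> ^ (k * b)) (int p)
      = Legendre (int \<gamma> ^ (k * a) * (1 + int \<gamma> ^ (k * r))) (int p)"
    by (intro Legendre_cong) (simp add: distrib_left)
  then show ?thesis
    using Legendre_even_power[OF prime gt_2 gamma_not_dvd[of 1], of "k * a"] even_k
    by (simp add: Legendre_mult[OF prime gt_2] c_def r_def)
qed

text \<open>The sum 1 + \<open>\<gamma> ^ (k * b)\<close> is symmetric in its two terms, and
  exchanging them negates the exponent difference.\<close>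

lemma c_minus: "c (- t) = c t"
proof -
  define b where "b = nat (t mod int m)"
  have t: "[t = int b] (mod int m)" using m_pos by (simp add: b_def cong_def)
  then have "c (- t) = c (- int b)"
    by (intro periodic_cong[OF periodic_c]) (simp add: cong_minus_minus_iff)
  also have "\<dots> = c (int b)"
    using Legendre_add_powers[of b 0] Legendre_add_powers[of 0 b] by (simp add: add.commute)
  also have "\<dots> = c t"
    by (rule periodic_cong[OF periodic_c cong_sym[OF t]])
  finally show ?thesis .
qed

lemma c_of_nat: "c (int s) = Legendre (1 + int \<gamma> ^ (k * s)) (int p)"
  using Legendre_add_powers[of 0 s] by simp

text \<open>The term x = 0 contributes Legendre 1 p = 1, which accounts for the a + 1. The nonzero x
  are the powers of \<open>\<gamma>\<close> with exponents below km, and these run k times through a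
  period of c.\<close>

lemma a_coeff_eq: "a_coeff p k + 1 = - (int k * (\<Sum>t<m. c (int t) * sign_char 0 (int t)))"
proof -
  have "(\<Sum>x = 0..<int p. Legendre (x ^ k + 1) (int p))
      = 1 + (\<Sum>s<k * m. Legendre ((int \<gamma> ^ s) ^ k + 1) (int p))"
    using k_pos gt_2
    by (subst sum_nonzero_residues[of "\<lambda>x. Legendre (x ^ k + 1) (int p)"])
      (auto intro!: Legendre_cong cong_add cong_pow simp: Legendre_1 power_0_left)
  also have "(\<Sum>s<k * m. Legendre ((int \<gamma> ^ s) ^ k + 1) (int p)) = (\<Sum>s<k * m. c (int s))"
    by (simp add: c_of_nat power_mult[symmetric] ac_simps)
  also have "\<dots> = int k * (\<Sum>t<m. c (int t))"
    using sum_lessThan_mult_periodic[of "\<lambda>s. c (int s)" m k] periodicD[OF periodic_c]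
    by (simp add: add.commute)
  finally show ?thesis
    by (simp add: a_coeff_Legendre[OF prime gt_2] sign_char_def)
qed

text \<open>Here x = 0 contributes nothing, and the extra factor x = \<open>\<gamma> ^ s\<close> has
  symbol (-1)^s. For even m this sign is periodic modulo m, so the sum again splits into k equal
  periods.\<close>

lemma b_coeff_eq:
  assumes "even m"
  shows "b_coeff p k = - (int k * (\<Sum>t<m. c (int t) * sign_char 1 (int t)))"
proof -
  have cong: "Legendre (x * (x ^ k + 1)) (int p) = Legendre (y * (y ^ k + 1)) (int p)"
    if "[x = y] (mod int p)" for x y
    by (rule Legendre_cong[OF cong_mult[OF that cong_add[OF cong_pow[OF that] cong_refl]]])
  have "Legendre 0 (int p) = 0" by (simp add: Legendre_def)
  then have "(\<Sum>x = 0..<int p. Legendre (x * (x ^ k + 1)) (int p))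
      = (\<Sum>s<k * m. Legendre (int \<gamma> ^ s * ((int \<gamma> ^ s) ^ k + 1)) (int p))"
    using sum_nonzero_residues[of "\<lambda>x. Legendre (x * (x ^ k + 1)) (int p)", OF cong]
    by simp
  also have "\<dots> = (\<Sum>s<k * m. c (int s) * sign_char 1 (int s))"
  proof (rule sum.cong[OF refl])
    fix s
    have "Legendre (int \<gamma> ^ s) (int p) = sign_char 1 (int s)"
      by (simp add: Legendre_power[OF prime gt_2] Legendre_gamma sign_char_def minus_one_power_iff)
    then show "Legendre (int \<gamma> ^ s * ((int \<gamma> ^ s) ^ k + 1)) (int p) = c (int s) * sign_char 1 (int s)"
      by (simp add: Legendre_mult[OF prime gt_2] c_of_nat power_mult[symmetric] ac_simps)
  qed
  also have "\<dots> = int k * (\<Sum>t<m. c (int t) * sign_char 1 (int t))"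
    using sum_lessThan_mult_periodic[of "\<lambda>s. c (int s) * sign_char 1 (int s)" m k]
      periodicD[OF periodic_c] assms
    by (simp add: add.commute sign_char_def)
  finally show ?thesis
    by (simp add: b_coeff_Legendre[OF prime gt_2])
qed

text \<open>The exponents kt with t < m are distinct and below km = p - 1, which gives injectivity.
  Conversely, a nonzero x is congruent to some \<open>\<gamma> ^ s\<close>, and the exponent of x^k
  = \<open>\<gamma> ^ (k * s)\<close> only depends on s modulo m.\<close>

lemma bij_power_residues:
  "bij_betw (\<lambda>t. int \<gamma> ^ (k * t) mod int p) {..<m} {a. 0 < a \<and> a < int p \<and> power_residue p k a}"
proof (rule bij_betw_imageI)
  show "inj_on (\<lambda>t. int \<gamma> ^ (k * t) mod int p) {..<m}"
  proof (rule inj_onI)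
    fix s t assume st: "s \<in> {..<m}" "t \<in> {..<m}"
      "int \<gamma> ^ (k * s) mod int p = int \<gamma> ^ (k * t) mod int p"
    then have "[int \<gamma> ^ (k * s) = int \<gamma> ^ (k * t)] (mod int p)"
      by (simp only: cong_def)
    then have "[k * s = k * t] (mod (p - 1))"
      by (rule gamma_power_cong_iff[THEN iffD1])
    then have "[k * s = k * t] (mod k * m)" by (simp add: p_eq)
    moreover have "k * s < k * m" "k * t < k * m" using st(1,2) k_pos by simp_all
    ultimately have "k * s = k * t" by (rule cong_less_modulus_unique_nat)
    then show "s = t" using k_pos by simp
  qed
next
  show "(\<lambda>t. int \<gamma> ^ (k * t) mod int p) ` {..<m} = {a. 0 < a \<and> a < int p \<and> power_residue p k a}"
  proof (rule equalityI; rule subsetI)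
    fix a assume "a \<in> (\<lambda>t. int \<gamma> ^ (k * t) mod int p) ` {..<m}"
    then obtain t where t: "t < m" and a: "a = int \<gamma> ^ (k * t) mod int p" by auto
    have "a \<in> {0<..<int p}"
    proof -
      have "k * t \<in> {..<p - 1}" using t k_pos p_eq by simp
      then have "a \<in> (\<lambda>s. int \<gamma> ^ s mod int p) ` {..<p - 1}" unfolding a by (rule imageI)
      then show ?thesis using bij_betw_imp_surj_on[OF bij_gamma_power] by simp
    qed
    then have "0 < a" "a < int p" "\<not> int p dvd a" by (simp_all add: zdvd_not_zless)
    moreover have "[a = (int \<gamma> ^ t) ^ k] (mod int p)"
      unfolding a cong_def by (simp add: power_mult[symmetric] mult.commute[of k])
    ultimately show "a \<in> {a. 0 < a \<and> a < int p \<and> power_residue p k a}"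
      unfolding power_residue_def by blast
  next
    fix a assume "a \<in> {a. 0 < a \<and> a < int p \<and> power_residue p k a}"
    then obtain x where a: "0 < a" "a < int p" "\<not> int p dvd a" and x: "[a = x ^ k] (mod int p)"
      by (auto simp: power_residue_def)
    have "\<not> int p dvd x"
    proof
      assume "int p dvd x"
      then have "[x ^ k = 0] (mod int p)" using k_pos dvd_trans[OF _ dvd_power, of "int p" x k] by (simp add: cong_0_iff)
      then have "[a = 0] (mod int p)" by (rule cong_trans[OF x])
      then show False using a(3) by (simp add: cong_0_iff)
    qed
    then have "x mod int p \<noteq> 0" by (simp add: dvd_eq_mod_eq_0)
    moreover have "0 \<le> x mod int p" "x mod int p < int p" using gt_2 by simp_all
    ultimately have "x mod int p \<in> {0<..<int p}" by simp
    then have "x mod int p \<in> (\<lambda>s. int \<gamma> ^ s mod int p) ` {..<p - 1}"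
      using bij_betw_imp_surj_on[OF bij_gamma_power] by simp
    then obtain s where "x mod int p = int \<gamma> ^ s mod int p" by blast
    then have "[x = int \<gamma> ^ s] (mod int p)" by (simp add: cong_def)
    then have "[x ^ k = (int \<gamma> ^ s) ^ k] (mod int p)" by (rule cong_pow)
    then have "[x ^ k = int \<gamma> ^ (k * s)] (mod int p)"
      by (simp only: power_mult[symmetric] mult.commute[of k])
    also have "[int \<gamma> ^ (k * s) = int \<gamma> ^ (k * (s mod m))] (mod int p)"
      by (rule gamma_k_power_cong) (simp add: cong_def)
    finally have "[a = int \<gamma> ^ (k * (s mod m))] (mod int p)"
      by (rule cong_trans[OF x])
    then have "a mod int p = int \<gamma> ^ (k * (s mod m)) mod int p" by (simp only: cong_def)
    then have "a = int \<gamma> ^ (k * (s mod m)) mod int p" using a by simp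
    moreover have "s mod m \<in> {..<m}" using m_pos by simp
    ultimately show "a \<in> (\<lambda>t. int \<gamma> ^ (k * t) mod int p) ` {..<m}" by (rule image_eqI)
  qed
qed

text \<open>The increasing list of residues and the list by exponents t < m enumerate the same set.
  The permutation between them turns the matrix into the circulant, rows and columns being permuted
  alike.\<close>

lemma det_W_mat:
  assumes mono: "strict_mono_on {1..m} \<alpha>"
    and range: "\<alpha> ` {1..m} = {a. 0 < a \<and> a < int p \<and> power_residue p k a}"
  shows "det (W_mat p m \<alpha>) = det (circulant m c)"
proof -
  let ?G = "\<lambda>t. int \<gamma> ^ (k * t) mod int p"
  have "bij_betw Suc {..<m} {1..m}"
    by (rule bij_betwI[of _ _ _ "\<lambda>n. n - 1"]) auto
  moreover have "bij_betw \<alpha> {1..m} {a. 0 < a \<and> a < int p \<and> power_residue p k a}"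
    using strict_mono_on_imp_inj_on[OF mono] range by (simp add: bij_betw_def)
  ultimately have "bij_betw (\<alpha> \<circ> Suc) {..<m} {a. 0 < a \<and> a < int p \<and> power_residue p k a}"
    by (rule bij_betw_trans)
  then have bij: "bij_betw (inv_into {..<m} ?G \<circ> (\<alpha> \<circ> Suc)) {..<m} {..<m}"
    by (rule bij_betw_trans[OF _ bij_betw_inv_into[OF bij_power_residues]])
  \<comment> \<open>\<open>\<sigma> i\<close> is the exponent of the residue at position i, counted
    from 0. Outside the index range it is the identity, as \<open>permutes\<close> demands.\<close>
  define \<sigma> where "\<sigma> i = (if i < m then inv_into {..<m} ?G (\<alpha> (Suc i)) else i)" for i
  have "bij_betw \<sigma> {..<m} {..<m}"
    using bij by (rule bij_betw_cong[THEN iffD1, rotated]) (simp add: \<sigma>_def)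
  then have \<sigma>: "\<sigma> permutes {0..<m}"
    by (intro bij_imp_permutes) (auto simp: \<sigma>_def atLeast0LessThan)
  have \<sigma>_eq: "[\<alpha> (Suc i) = int \<gamma> ^ (k * \<sigma> i)] (mod int p)" if "i < m" for i
  proof -
    have "\<alpha> (Suc i) \<in> ?G ` {..<m}"
      using that range bij_power_residues by (auto simp: bij_betw_def)
    then have "?G (\<sigma> i) = \<alpha> (Suc i)"
      using f_inv_into_f[of "\<alpha> (Suc i)" ?G "{..<m}"] that by (simp add: \<sigma>_def)
    then show ?thesis by (metis cong_def mod_mod_trivial)
  qed
  have "W_mat p m \<alpha> = mat m m (\<lambda>(i, j). c (int (\<sigma> j) - int (\<sigma> i)))"
  proof (rule eq_matI)
    fix i j assume "i < dim_row (mat m m (\<lambda>(i, j). c (int (\<sigma> j) - int (\<sigma> i))))"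
      "j < dim_col (mat m m (\<lambda>(i, j). c (int (\<sigma> j) - int (\<sigma> i))))"
    then have ij: "i < m" "j < m" by simp_all
    have "Legendre (\<alpha> (Suc i) + \<alpha> (Suc j)) (int p) = c (int (\<sigma> j) - int (\<sigma> i))"
      unfolding Legendre_add_powers[symmetric] by (intro Legendre_cong cong_add \<sigma>_eq ij)
    then show "W_mat p m \<alpha> $$ (i, j) = mat m m (\<lambda>(i, j). c (int (\<sigma> j) - int (\<sigma> i))) $$ (i, j)"
      using ij by (simp add: W_mat_def)
  qed (simp_all add: W_mat_def)
  then show ?thesis
    using det_permute_rows_cols[OF \<sigma>, of "\<lambda>i j. c (int j - int i)"] by (simp add: circulant_def)
qed

end

section \<open>Assembly of the odd and the even case\<close>

theorem theorem1p1:
  fixes p k m :: nat and \<alpha> :: "nat \<Rightarrow> int"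
  assumes "prime p" and "odd p"
    and "k \<ge> 2" and "even k" and "p = k * m + 1"
    and "strict_mono_on {1..m} \<alpha>"
    and "\<alpha> ` {1..m} = {a. 0 < a \<and> a < int p \<and> power_residue p k a}"
  shows "(odd m \<longrightarrow> (\<exists>u::int. (of_int (det (W_mat p m \<alpha>)) :: rat) =
           - (of_int (a_coeff p k) + 1) * of_int u ^ 2 / of_nat k)) \<and>
         (even m \<longrightarrow> (\<exists>v::int. (of_int (det (W_mat p m \<alpha>)) :: rat) =
           (of_int (a_coeff p k) + 1) * of_int (b_coeff p k) * of_int v ^ 2 / of_nat k ^ 2))"
proof -
  have "2 < p"
    using prime_ge_2_nat[OF assms(1)] assms(2) by (cases "p = 2") auto
  obtain \<gamma> where "residue_primroot p \<gamma>"
    using prime_primitive_root_exists[OF _ assms(1)] \<open>2 < p\<close> by auto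
  then interpret primroot_power_residues p k m \<gamma>
    by unfold_locales (use assms \<open>2 < p\<close> in auto)
  define \<mu> where "\<mu> s = (\<Sum>t<m. c (int t) * sign_char s (int t))" for s
  have a: "(of_int (a_coeff p k) + 1 :: rat) = - (of_nat k * of_int (\<mu> 0))"
    using arg_cong[OF a_coeff_eq, of "of_int :: int \<Rightarrow> rat"] by (simp add: \<mu>_def)
  have k0: "(of_nat k :: rat) \<noteq> 0" using assms(3) by simp
  note det = det_W_mat[OF assms(6,7)]
  show ?thesis
  proof (intro conjI impI)
    assume "odd m"
    then obtain h where "m = 1 + 2 * h" by (auto elim: oddE)
    from det_even_circulant[OF this _ periodic_c c_minus]
    obtain u where "det (W_mat p m \<alpha>) = \<mu> 0 * u ^ 2"
      by (auto simp: det \<mu>_def)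
    then have "(of_int (det (W_mat p m \<alpha>)) :: rat) =
        - (of_int (a_coeff p k) + 1) * of_int u ^ 2 / of_nat k"
      using k0 by (simp add: a)
    then show "\<exists>u::int. (of_int (det (W_mat p m \<alpha>)) :: rat) =
        - (of_int (a_coeff p k) + 1) * of_int u ^ 2 / of_nat k" ..
  next
    assume "even m"
    then obtain h' where "m = 2 * h'" by (auto elim: evenE)
    \<comment> \<open>Positivity of m gives h' at least 1, so the natural-number subtraction is
      exact; the 2 counts the constant and the alternating eigenfunctions.\<close>
    then have "m = 2 + 2 * (h' - 1)" using m_pos by simp
    from det_even_circulant[OF this _ periodic_c c_minus]
    obtain u where u: "det (W_mat p m \<alpha>) = \<mu> 0 * \<mu> 1 * u ^ 2"
      by (auto simp: det \<mu>_def numeral_2_eq_2)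
    have b: "(of_int (b_coeff p k) :: rat) = - (of_nat k * of_int (\<mu> 1))"
      using arg_cong[OF b_coeff_eq[OF \<open>even m\<close>], of "of_int :: int \<Rightarrow> rat"] by (simp add: \<mu>_def)
    \<comment> \<open>Each eigenvalue carries a factor -1/k, and the two minus signs cancel, whereas
      one survives for odd m.\<close>
    have "(of_int (det (W_mat p m \<alpha>)) :: rat) =
        (of_int (a_coeff p k) + 1) * of_int (b_coeff p k) * of_int u ^ 2 / of_nat k ^ 2"
      using k0 by (simp add: a b u power2_eq_square)
    then show "\<exists>v::int. (of_int (det (W_mat p m \<alpha>)) :: rat) =
        (of_int (a_coeff p k) + 1) * of_int (b_coeff p k) * of_int v ^ 2 / of_nat k ^ 2" ..
  qed
qed

end
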